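(* Let $G$ be a topological group and let $f\in\mathcal{H}(G)\cap\mathcal{W}(G)$ be a weakly almost periodic Hartman function. Let $(\iota,C)$ be a group compactification of $G$ on which $f$ is realized by a $\mu_C$-Riemann integrable function $F:C\to\mathbb{C}$, i.e. $f=F\circ\iota$. Then $F$ has no generalized jump discontinuity.
   Context: Compact spaces are Hausdorff. A group compactification of $G$ is a pair $(\iota,C)$ where $C$ is a compact topological group and $\iota:G\to C$ is a continuous group homomorphism with dense image. $\mu_C$ denotes the (completed) normalized Haar measure on $C$. A bounded function $F:C\to\mathbb{C}$ is $\mu_C$-Riemann integrable if its set of discontinuity points is $\mu_C$-null. $\mathcal{H}(G)$ (Hartman functions) is the set of bounded $f:G\to\mathbb{C}$ of the form $f=F\circ\iota$ with $F$ $\mu_C$-Riemann integrable on some group compactification $(\iota,C)$ of $G$. $B(G)$ is the Banach space of bounded functions $G\to\mathbb{C}$ with the supremum norm. $\mathcal{W}(G)$ is the set of weakly almost periodic functions, i.e. bounded $f:G\to\mathbb{C}$ such that the set $\{L_sf:s\in G\}$ of left translates, $L_sf(t)=f(st)$, is relatively compact in the weak topology of $B(G)$. A function $f:X\to Y$ between topological spaces has a generalized jump discontinuity (g.j.d.) at $x\in X$ if there are disjoint open sets $O_1,O_2\subseteq X$ with $x\in\overline{O_1}\cap\overline{O_2}$ but $\overline{f(O_1)}\cap\overline{f(O_2)}=\emptyset$. *)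

theory Defs
  imports "HOL-Analysis.Analysis" "HOL-Algebra.Coset"
begin

text \<open>Only compact spaces are required to be Hausdorff; a topological group need not be.\<close>

definition topological_group :: "('a, 'm) monoid_scheme \<Rightarrow> 'a topology \<Rightarrow> bool" where
  "topological_group G T \<longleftrightarrow>
     group G \<and> topspace T = carrier G \<and>
     continuous_map (prod_topology T T) T (\<lambda>(x, y). x \<otimes>\<^bsub>G\<^esub> y) \<and>
     continuous_map T T (\<lambda>x. inv\<^bsub>G\<^esub> x)"

definition compact_topological_group :: "('a, 'm) monoid_scheme \<Rightarrow> 'a topology \<Rightarrow> bool" where
  "compact_topological_group C T \<longleftrightarrow>
     topological_group C T \<and> compact_space T \<and> Hausdorff_space T"

definition group_compactification ::
    "('g, 'm) monoid_scheme \<Rightarrow> 'g topology \<Rightarrow> ('g \<Rightarrow> 'c) \<Rightarrow>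
     ('c, 'n) monoid_scheme \<Rightarrow> 'c topology \<Rightarrow> bool" where
  "group_compactification G TG \<iota> C TC \<longleftrightarrow>
     compact_topological_group C TC \<and>
     \<iota> \<in> hom G C \<and> continuous_map TG TC \<iota> \<and>
     TC closure_of (\<iota> ` carrier G) = topspace TC"

text \<open>The normalized Haar measure is the unique left invariant regular Borel probability
  measure. Regularity is part of the definition because, without second countability, it is
  not automatic. Null sets are taken with respect to the completion.\<close>

definition is_normalized_haar ::
    "('c, 'n) monoid_scheme \<Rightarrow> 'c topology \<Rightarrow> 'c measure \<Rightarrow> bool" where
  "is_normalized_haar C T \<mu> \<longleftrightarrow>
     space \<mu> = topspace T \<and>
     sets \<mu> = sigma_sets (topspace T) {U. openin T U} \<and>
     emeasure \<mu> (topspace T) = 1 \<and>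
     (\<forall>c\<in>carrier C. \<forall>A\<in>sets \<mu>. emeasure \<mu> (c <#\<^bsub>C\<^esub> A) = emeasure \<mu> A) \<and>
     (\<forall>A\<in>sets \<mu>. emeasure \<mu> A = (INF U\<in>{U. openin T U \<and> A \<subseteq> U}. emeasure \<mu> U)) \<and>
     (\<forall>U. openin T U \<longrightarrow>
        emeasure \<mu> U = (SUP K\<in>{K. compactin T K \<and> K \<subseteq> U}. emeasure \<mu> K))"

definition haar_measure :: "('c, 'n) monoid_scheme \<Rightarrow> 'c topology \<Rightarrow> 'c measure" where
  "haar_measure C T = completion (THE \<mu>. is_normalized_haar C T \<mu>)"

definition riemann_integrable ::
    "('c, 'n) monoid_scheme \<Rightarrow> 'c topology \<Rightarrow> ('c \<Rightarrow> complex) \<Rightarrow> bool" where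
  "riemann_integrable C T F \<longleftrightarrow>
     bounded (F ` carrier C) \<and>
     {x \<in> topspace T. \<not> topcontinuous_at T euclidean F x} \<in> null_sets (haar_measure C T)"

text \<open>A bounded function on the set \<open>X\<close> is represented by its extension by zero outside \<open>X\<close>, so
  that the pointwise operations turn \<open>bounded_funs X\<close> into a vector space and equality is
  equality on \<open>X\<close>.\<close>

definition bounded_funs :: "'a set \<Rightarrow> ('a \<Rightarrow> complex) set" where
  "bounded_funs X = {f. bounded (f ` X) \<and> (\<forall>x. x \<notin> X \<longrightarrow> f x = 0)}"

definition sup_norm :: "'a set \<Rightarrow> ('a \<Rightarrow> complex) \<Rightarrow> real" where
  "sup_norm X f = (SUP x\<in>X. cmod (f x))"

definition bounded_funs_dual :: "'a set \<Rightarrow> (('a \<Rightarrow> complex) \<Rightarrow> complex) set" where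
  "bounded_funs_dual X = {\<phi>.
     (\<forall>f\<in>bounded_funs X. \<forall>g\<in>bounded_funs X. \<phi> (\<lambda>x. f x + g x) = \<phi> f + \<phi> g) \<and>
     (\<forall>a. \<forall>f\<in>bounded_funs X. \<phi> (\<lambda>x. a * f x) = a * \<phi> f) \<and>
     (\<exists>K. \<forall>f\<in>bounded_funs X. cmod (\<phi> f) \<le> K * sup_norm X f)}"

definition weak_topology :: "'a set \<Rightarrow> ('a \<Rightarrow> complex) topology" where
  "weak_topology X = topology_generated_by
     {{f \<in> bounded_funs X. \<phi> f \<in> U} |\<phi> U. \<phi> \<in> bounded_funs_dual X \<and> open U}"

lemma topspace_weak_topology: "topspace (weak_topology X) = bounded_funs X"
proof -
  have "\<exists>K. \<forall>f\<in>bounded_funs X. cmod 0 \<le> K * sup_norm X f"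
    by (rule exI[where x = 0]) simp
  then have "(\<lambda>_. 0) \<in> bounded_funs_dual X"
    by (simp add: bounded_funs_dual_def)
  then have "bounded_funs X \<in>
      {{f \<in> bounded_funs X. \<phi> f \<in> U} |\<phi> U. \<phi> \<in> bounded_funs_dual X \<and> open U}"
    by (intro CollectI exI[where x = "\<lambda>_. 0"] exI[where x = UNIV]) simp
  then show ?thesis
    unfolding weak_topology_def topology_generated_by_topspace by blast
qed

definition left_translate ::
    "('g, 'm) monoid_scheme \<Rightarrow> 'g \<Rightarrow> ('g \<Rightarrow> complex) \<Rightarrow> ('g \<Rightarrow> complex)" where
  "left_translate G s f = (\<lambda>t. if t \<in> carrier G then f (s \<otimes>\<^bsub>G\<^esub> t) else 0)"

definition weakly_almost_periodic :: "('g, 'm) monoid_scheme \<Rightarrow> ('g \<Rightarrow> complex) set" where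
  "weakly_almost_periodic G = {f \<in> bounded_funs (carrier G).
     compactin (weak_topology (carrier G))
       (weak_topology (carrier G) closure_of ((\<lambda>s. left_translate G s f) ` carrier G))}"

text \<open>The definition ranges over compactifications whose elements are of type \<open>'g set set\<close>. This is
  no restriction: by the following lemma the carrier of any compactification of \<open>G\<close>, of whatever
  type, injects into that type, so every compactification has an isomorphic copy there.\<close>

lemma group_compactification_inj:
  assumes "group_compactification G TG \<iota> C TC"
  shows "inj_on (\<lambda>c. {{x \<in> carrier G. \<iota> x \<in> U} |U. openin TC U \<and> c \<in> U}) (carrier C)"
proof (rule inj_onI, rule ccontr)
  fix c d
  assume cd: "c \<in> carrier C" "d \<in> carrier C" "c \<noteq> d"
    and eq: "{{x \<in> carrier G. \<iota> x \<in> U} |U. openin TC U \<and> c \<in> U} =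
             {{x \<in> carrier G. \<iota> x \<in> U} |U. openin TC U \<and> d \<in> U}"
  have TC: "Hausdorff_space TC" "topspace TC = carrier C"
    "TC closure_of (\<iota> ` carrier G) = topspace TC"
    using assms by (auto simp: group_compactification_def compact_topological_group_def
        topological_group_def)
  then obtain U V where UV: "openin TC U" "openin TC V" "c \<in> U" "d \<in> V" "disjnt U V"
    using cd unfolding Hausdorff_space_def by metis
  have "{x \<in> carrier G. \<iota> x \<in> U} \<in> {{x \<in> carrier G. \<iota> x \<in> U} |U. openin TC U \<and> d \<in> U}"
    unfolding eq[symmetric] using UV(1,3) by (intro CollectI exI[where x = U]) simp
  then obtain U' where U': "openin TC U'" "d \<in> U'"
    "{x \<in> carrier G. \<iota> x \<in> U} = {x \<in> carrier G. \<iota> x \<in> U'}"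
    by blast
  have "openin TC (U' \<inter> V)" "d \<in> U' \<inter> V" "d \<in> TC closure_of (\<iota> ` carrier G)"
    using UV U' TC cd by auto
  then obtain x where "x \<in> carrier G" "\<iota> x \<in> U' \<inter> V"
    unfolding in_closure_of by blast
  then show False
    using U'(3) UV(5) by (auto simp: disjnt_iff)
qed

definition hartman :: "('g, 'm) monoid_scheme \<Rightarrow> 'g topology \<Rightarrow> ('g \<Rightarrow> complex) set" where
  "hartman G TG = {f \<in> bounded_funs (carrier G).
     \<exists>(C :: 'g set set monoid) TC \<iota> F.
       group_compactification G TG \<iota> C TC \<and> riemann_integrable C TC F \<and>
       (\<forall>x\<in>carrier G. f x = F (\<iota> x))}"

definition gen_jump_discontinuity ::
    "'a topology \<Rightarrow> 'b topology \<Rightarrow> ('a \<Rightarrow> 'b) \<Rightarrow> 'a \<Rightarrow> bool" where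
  "gen_jump_discontinuity X Y f x \<longleftrightarrow>
     x \<in> topspace X \<and>
     (\<exists>O1 O2. openin X O1 \<and> openin X O2 \<and> O1 \<inter> O2 = {} \<and>
        x \<in> X closure_of O1 \<inter> X closure_of O2 \<and>
        Y closure_of (f ` O1) \<inter> Y closure_of (f ` O2) = {})"

end

theory Submission
  imports Defs
begin

text \<open>
  If \<open>x\<close> is a generalized jump discontinuity witnessed by \<open>O1\<close> and \<open>O2\<close>, choose inductively
  \<open>s\<^sub>k, t\<^sub>k \<in> G\<close> such that \<open>\<iota> s\<^sub>k\<close> is close to the identity with \<open>\<iota> s\<^sub>k x \<in> O1\<close>, and \<open>\<iota> t\<^sub>k\<close> is
  close to \<open>x\<close> with \<open>\<iota> t\<^sub>k \<in> O2\<close>. Then \<open>\<iota> (s\<^sub>m t\<^sub>n)\<close> lies in \<open>O1\<close> for \<open>m < n\<close> and in \<open>O2\<close> for \<open>n < m\<close>,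
  which violates Grothendieck's double limit condition: let \<open>h\<close> be a weak cluster point of the
  translates of \<open>f\<close> by \<open>s\<^sub>m\<close> and \<open>\<phi>\<close> a weak* cluster point of the evaluations at \<open>t\<^sub>n\<close>; then \<open>\<phi> h\<close>
  lies in the closures of both \<open>F O1\<close> and \<open>F O2\<close>.
\<close>

section \<open>Cluster points of sequences in compact sets\<close>

lemma compactin_cluster_point:
  fixes a :: "nat \<Rightarrow> 'a"
  assumes K: "compactin X K" and a: "\<And>n. a n \<in> K"
  obtains p where "p \<in> K" "\<And>N. p \<in> X closure_of (a ` {N..})"
proof -
  let ?U = "range (\<lambda>N. X closure_of (a ` {N..}))"
  have sub: "a ` {N..} \<subseteq> X closure_of (a ` {N..})" for N
    using compactin_subset_topspace[OF K] a by (intro closure_of_subset) blast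
  \<comment> \<open>Tails decrease, so finitely many of the closures share a term \<open>a M\<close>
    with \<open>M\<close> beyond all their indices. A cluster point replaces a convergent
    subsequence, which need not exist in the product topology used below.\<close>
  have "K \<inter> \<Inter>?U \<noteq> {}"
  proof (rule compactin_fip[THEN iffD1, OF K, THEN conjunct2, rule_format], intro conjI ballI allI impI)
    fix \<F> assume "finite \<F> \<and> \<F> \<subseteq> ?U"
    then obtain I where I: "finite I" "\<F> = (\<lambda>N. X closure_of (a ` {N..})) ` I"
      by (meson finite_subset_image)
    obtain M where M: "\<forall>N\<in>I. N \<le> M"
      using finite_nat_set_iff_bounded_le I(1) by blast
    have "a M \<in> X closure_of (a ` {N..})" if "N \<in> I" for N
      using sub[of N] M that by blast
    then show "K \<inter> \<Inter>\<F> \<noteq> {}"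
      using a[of M] I(2) by blast
  qed auto
  then show ?thesis
    using that by blast
qed

text \<open>The device for passing to cluster points: a condition on a tail survives up to closure.
  With \<open>A = {0}\<close> it transfers algebraic identities.\<close>

lemma continuous_map_closure_of_mem:
  fixes g :: "'a \<Rightarrow> 'b::topological_space"
  assumes "continuous_map X euclidean g" "p \<in> X closure_of S" "\<And>a. a \<in> S \<Longrightarrow> g a \<in> A"
  shows "g p \<in> closure A"
proof -
  have "g p \<in> closure (g ` S)"
    using continuous_map_image_closure_subset[OF assms(1), of S] assms(2)
    by auto
  also have "closure (g ` S) \<subseteq> closure A"
    using assms(3) by (intro closure_mono) blast
  finally show ?thesis .
qed

section \<open>Bounded functions, their dual and the weak topology\<close>

lemma bounded_funs_add:
  assumes "f \<in> bounded_funs X" "g \<in> bounded_funs X"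
  shows "(\<lambda>x. f x + g x) \<in> bounded_funs X"
  using assms bounded_plus_comp by (auto simp: bounded_funs_def)

lemma bounded_funs_mult:
  assumes "f \<in> bounded_funs X"
  shows "(\<lambda>x. a * f x) \<in> bounded_funs X"
proof -
  have "bounded ((*) a ` f ` X)"
    using assms by (intro bounded_linear_image bounded_linear_mult_right) (auto simp: bounded_funs_def)
  then show ?thesis
    using assms by (auto simp: bounded_funs_def image_image)
qed

lemma norm_le_sup_norm:
  assumes "f \<in> bounded_funs X" "x \<in> X"
  shows "cmod (f x) \<le> sup_norm X f"
proof -
  have "bdd_above ((\<lambda>x. cmod (f x)) ` X)"
    using assms(1) by (auto simp: bounded_funs_def bounded_iff bdd_above_def)
  then show ?thesis
    unfolding sup_norm_def using assms(2) by (rule cSUP_upper2) simp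
qed

lemma evaluation_in_bounded_funs_dual:
  assumes "t \<in> X"
  shows "(\<lambda>f. f t) \<in> bounded_funs_dual X"
  unfolding bounded_funs_dual_def
  using norm_le_sup_norm[OF _ assms] by (auto intro!: exI[where x = 1])

lemma continuous_map_weak_topology:
  assumes "\<phi> \<in> bounded_funs_dual X"
  shows "continuous_map (weak_topology X) euclidean \<phi>"
  unfolding continuous_map topspace_weak_topology
proof (intro conjI allI impI)
  fix U :: "complex set" assume "openin euclidean U"
  then show "openin (weak_topology X) {f \<in> bounded_funs X. \<phi> f \<in> U}"
    unfolding weak_topology_def using assms by (intro topology_generated_by_Basis) auto
qed auto

text \<open>As in Banach-Alaoglu, all evaluations lie in a product of closed discs of radius
  \<open>sup_norm X g\<close>, which is compact by Tychonoff. A cluster point there acts as a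
  generalized limit of \<open>g (t n)\<close>.\<close>

lemma evaluations_cluster_functional:
  fixes t :: "nat \<Rightarrow> 'a"
  assumes t: "\<And>n. t n \<in> X"
  obtains \<phi> where "\<phi> \<in> bounded_funs_dual X"
    "\<And>g A N. \<lbrakk>g \<in> bounded_funs X; \<And>n. N \<le> n \<Longrightarrow> g (t n) \<in> A\<rbrakk> \<Longrightarrow> \<phi> g \<in> closure A"
proof -
  let ?B = "bounded_funs X" and ?P = "product_topology (\<lambda>_. euclidean :: complex topology) (bounded_funs X)"
  let ?K = "PiE ?B (\<lambda>g. cball 0 (sup_norm X g))" and ?e = "\<lambda>n. restrict (\<lambda>g. g (t n)) ?B"
  have "compactin ?P ?K"
    by (auto simp: compactin_PiE)
  moreover have "?e n \<in> ?K" for n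
    using norm_le_sup_norm t by fastforce
  ultimately obtain \<phi> where \<phi>: "\<phi> \<in> ?K" "\<And>N. \<phi> \<in> ?P closure_of (?e ` {N..})"
    by (rule compactin_cluster_point[where a = ?e]) blast
  have proj: "continuous_map ?P euclidean (\<lambda>\<psi>. \<psi> g)" if "g \<in> ?B" for g
    using that by (rule continuous_map_product_projection)
  have "\<phi> (\<lambda>x. f x + g x) = \<phi> f + \<phi> g" if "f \<in> ?B" "g \<in> ?B" for f g
  proof -
    \<comment> \<open>The additivity defect is continuous in \<open>\<psi>\<close> for the product
      topology and vanishes at every evaluation, so it vanishes at \<open>\<phi>\<close>.\<close>
    have "\<phi> (\<lambda>x. f x + g x) - (\<phi> f + \<phi> g) \<in> closure {0}"
      using that bounded_funs_add[OF that]
      by (intro continuous_map_closure_of_mem[OF _ \<phi>(2)[of 0],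
            where g = "\<lambda>\<psi>. \<psi> (\<lambda>x. f x + g x) - (\<psi> f + \<psi> g)"]
          continuous_map_diff continuous_map_add proj) auto
    then show ?thesis by simp
  qed
  moreover have "\<phi> (\<lambda>x. a * f x) = a * \<phi> f" if "f \<in> ?B" for a f
  proof -
    have "continuous_map ?P euclidean (\<lambda>\<psi>. a * \<psi> f)"
      using proj[OF that] by (simp add: continuous_map_atin tendsto_mult_left)
    then have "\<phi> (\<lambda>x. a * f x) - a * \<phi> f \<in> closure {0}"
      using that bounded_funs_mult[OF that]
      by (intro continuous_map_closure_of_mem[OF _ \<phi>(2)[of 0],
            where g = "\<lambda>\<psi>. \<psi> (\<lambda>x. a * f x) - a * \<psi> f"]
          continuous_map_diff proj) auto
    then show ?thesis by simp
  qed
  moreover have "cmod (\<phi> f) \<le> 1 * sup_norm X f" if "f \<in> ?B" for f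
    using \<phi>(1) that by (auto dest: PiE_mem)
  ultimately have "\<phi> \<in> bounded_funs_dual X"
    unfolding bounded_funs_dual_def by blast
  moreover have "\<phi> g \<in> closure A" if "g \<in> ?B" "\<And>n. N \<le> n \<Longrightarrow> g (t n) \<in> A" for g A N
    by (rule continuous_map_closure_of_mem[OF proj[OF that(1)] \<phi>(2)[of N]]) (use that in auto)
  ultimately show ?thesis
    using that by blast
qed

section \<open>Grothendieck's double limit condition\<close>

lemma left_translate_in_bounded_funs:
  assumes "group G" "f \<in> bounded_funs (carrier G)" "s \<in> carrier G"
  shows "left_translate G s f \<in> bounded_funs (carrier G)"
proof -
  interpret group G by fact
  have "left_translate G s f ` carrier G \<subseteq> f ` carrier G"
    using assms(3) by (auto simp: left_translate_def)
  then show ?thesis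
    using assms(2) by (auto simp: bounded_funs_def left_translate_def intro: bounded_subset)
qed

text \<open>The single number \<open>\<phi> h\<close> is reached in both orders: through
  \<open>\<phi>\<close> at each translate, and through \<open>h\<close> at each point
  \<open>t n\<close>. Closures stand in for iterated limits, which need not exist.\<close>

lemma weakly_almost_periodic_double_limit:
  fixes s t :: "nat \<Rightarrow> 'g"
  assumes G: "group G" and f: "f \<in> weakly_almost_periodic G"
    and s: "\<And>n. s n \<in> carrier G" and t: "\<And>n. t n \<in> carrier G"
    and A: "\<And>m n. m < n \<Longrightarrow> f (s m \<otimes>\<^bsub>G\<^esub> t n) \<in> A"
    and B: "\<And>m n. n < m \<Longrightarrow> f (s m \<otimes>\<^bsub>G\<^esub> t n) \<in> B"
  shows "closure A \<inter> closure B \<noteq> {}"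
proof -
  let ?X = "carrier G" and ?L = "\<lambda>s. left_translate G s f"
  let ?W = "weak_topology (carrier G)"
  have "f \<in> bounded_funs ?X" and K: "compactin ?W (?W closure_of (?L ` ?X))"
    using f by (auto simp: weakly_almost_periodic_def)
  then have L: "?L ` ?X \<subseteq> bounded_funs ?X"
    using left_translate_in_bounded_funs[OF G] by blast
  then have "?L (s m) \<in> ?W closure_of (?L ` ?X)" for m
    using closure_of_subset[of "?L ` ?X" ?W] s by (auto simp: topspace_weak_topology)
  then obtain h where h: "h \<in> ?W closure_of (?L ` ?X)"
      "\<And>N. h \<in> ?W closure_of ((\<lambda>m. ?L (s m)) ` {N..})"
    using compactin_cluster_point[OF K, of "\<lambda>m. ?L (s m)"] by blast
  obtain \<phi> where \<phi>: "\<phi> \<in> bounded_funs_dual ?X"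
      "\<And>g A N. \<lbrakk>g \<in> bounded_funs ?X; \<And>n. N \<le> n \<Longrightarrow> g (t n) \<in> A\<rbrakk> \<Longrightarrow> \<phi> g \<in> closure A"
    using evaluations_cluster_functional[of t ?X] t by blast
  \<comment> \<open>For fixed \<open>m\<close> only the tail \<open>n > m\<close> counts, hence
    \<open>Suc m\<close>; nothing is known on the diagonal.\<close>
  have "\<phi> (?L (s m)) \<in> closure A" for m
    by (rule \<phi>(2)[where N = "Suc m"])
      (use L s A t in \<open>auto simp: left_translate_def Suc_le_eq\<close>)
  then have "\<phi> h \<in> closure (closure A)"
    by (intro continuous_map_closure_of_mem[OF continuous_map_weak_topology[OF \<phi>(1)] h(2)[of 0]]) auto
  \<comment> \<open>Now \<open>n\<close> is fixed first: weak closeness implies closeness at the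
    point \<open>t n\<close>, and the tail \<open>m > n\<close> is used.\<close>
  moreover have "h (t n) \<in> closure B" for n
    by (rule continuous_map_closure_of_mem[OF continuous_map_weak_topology[OF
            evaluation_in_bounded_funs_dual[OF t]] h(2)[of "Suc n"]])
      (use B t in \<open>auto simp: left_translate_def Suc_le_eq\<close>)
  then have "\<phi> h \<in> closure (closure B)"
    using h(1) by (intro \<phi>(2)[where N = 0]) (auto simp: in_closure_of topspace_weak_topology)
  ultimately show ?thesis
    by auto
qed

section \<open>Double sequences in a dense image\<close>

lemma topological_group_continuous_map_mult:
  assumes "topological_group C T" "continuous_map X T f" "continuous_map X T g"
  shows "continuous_map X T (\<lambda>c. f c \<otimes>\<^bsub>C\<^esub> g c)"
proof -
  have "continuous_map X T ((\<lambda>(x, y). x \<otimes>\<^bsub>C\<^esub> y) \<circ> (\<lambda>c. (f c, g c)))"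
    using assms by (intro continuous_map_compose[of _ "prod_topology T T"])
      (auto simp: topological_group_def continuous_map_pairedI)
  then show ?thesis
    by (simp add: o_def)
qed

lemma openin_finite_preimages:
  assumes "finite S" "\<And>s. s \<in> S \<Longrightarrow> continuous_map X Y (k s)" "openin Y U"
  shows "openin X {c \<in> topspace X. \<forall>s\<in>S. k s c \<in> U}"
\<comment> \<open>An empty intersection would be \<open>UNIV\<close> instead of
  \<open>topspace X\<close>. This case occurs at the start of the construction below.\<close>
proof (cases "S = {}")
  case False
  have "openin X (\<Inter>s\<in>S. {c \<in> topspace X. k s c \<in> U})"
    using assms False by (intro openin_INT2 openin_continuous_map_preimage) auto
  moreover have "(\<Inter>s\<in>S. {c \<in> topspace X. k s c \<in> U}) = {c \<in> topspace X. \<forall>s\<in>S. k s c \<in> U}"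
    using False by auto
  ultimately show ?thesis by simp
qed simp

lemma closure_of_meets_openin:
  assumes "p \<in> X closure_of S" "openin X U" "p \<in> U"
  obtains y where "y \<in> S" "y \<in> U"
  using assms unfolding in_closure_of by blast

lemma dense_image_meets_openin:
  assumes "X closure_of (\<iota> ` S) = topspace X" "openin X U" "c \<in> U"
  obtains g where "g \<in> S" "\<iota> g \<in> U"
proof -
  have "c \<in> X closure_of (\<iota> ` S)"
    using assms openin_subset by blast
  then show ?thesis
    using closure_of_meets_openin[OF _ assms(2,3)] that by blast
qed

text \<open>For \<open>y\<close> in \<open>O1\<close> near \<open>x\<close>, the element
  \<open>y\<close> times the inverse of \<open>x\<close> is near the identity, so it keeps the
  finite set \<open>R\<close> inside \<open>O2\<close>, yet it moves \<open>x\<close> to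
  \<open>y\<close>. For \<open>t\<close>, points of \<open>O2\<close> near \<open>x\<close> serve.
  All conditions are open, so density moves both choices into the image of
  \<open>\<iota>\<close>.\<close>

lemma dense_double_sequence_step:
  assumes C: "topological_group C T" and dense: "T closure_of (\<iota> ` X) = topspace T"
    and O: "openin T O1" "openin T O2" "x \<in> T closure_of O1" "x \<in> T closure_of O2"
    and ST: "finite S" "finite R" "S \<subseteq> carrier C" "R \<subseteq> carrier C"
      "\<forall>r\<in>S. r \<otimes>\<^bsub>C\<^esub> x \<in> O1" "R \<subseteq> O2"
  obtains s t where "s \<in> X" "t \<in> X" "\<iota> s \<otimes>\<^bsub>C\<^esub> x \<in> O1" "\<iota> t \<in> O2"
    "\<forall>r\<in>R. \<iota> s \<otimes>\<^bsub>C\<^esub> r \<in> O2" "\<forall>r\<in>S. r \<otimes>\<^bsub>C\<^esub> \<iota> t \<in> O1"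
proof -
  interpret group C using C by (simp add: topological_group_def)
  have top: "topspace T = carrier C"
    using C by (simp add: topological_group_def)
  have x: "x \<in> carrier C"
    using O(3) top by (simp add: in_closure_of)
  have cont [intro]: "continuous_map T T (\<lambda>c. c \<otimes>\<^bsub>C\<^esub> a)" "continuous_map T T (\<lambda>c. a \<otimes>\<^bsub>C\<^esub> c)"
    if "a \<in> carrier C" for a
    using that top by (auto intro!: topological_group_continuous_map_mult[OF C])
  have U: "openin T {c \<in> topspace T. \<forall>r\<in>R. c \<otimes>\<^bsub>C\<^esub> r \<in> O2}" (is "openin T ?U")
    using ST O by (intro openin_finite_preimages) auto
  have V: "openin T {c \<in> topspace T. c \<otimes>\<^bsub>C\<^esub> x \<in> O1}" (is "openin T ?V")
    using O x by (intro openin_continuous_map_preimage) auto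
  have W: "openin T {c \<in> topspace T. \<forall>r\<in>S. r \<otimes>\<^bsub>C\<^esub> c \<in> O1}" (is "openin T ?W")
    using ST O by (intro openin_finite_preimages) auto
  have "openin T {c \<in> topspace T. c \<otimes>\<^bsub>C\<^esub> inv\<^bsub>C\<^esub> x \<in> ?U}"
    using U x by (intro openin_continuous_map_preimage) auto
  \<comment> \<open>At \<open>c = x\<close> the product is the identity, which lies in
    \<open>?U\<close> because \<open>R \<subseteq> O2\<close>.\<close>
  moreover have "x \<in> {c \<in> topspace T. c \<otimes>\<^bsub>C\<^esub> inv\<^bsub>C\<^esub> x \<in> ?U}"
    using x top ST by (auto simp: subset_iff)
  ultimately obtain y where y: "y \<in> O1" "y \<in> {c \<in> topspace T. c \<otimes>\<^bsub>C\<^esub> inv\<^bsub>C\<^esub> x \<in> ?U}"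
    by (rule closure_of_meets_openin[OF O(3)])
  then have "y \<otimes>\<^bsub>C\<^esub> inv\<^bsub>C\<^esub> x \<in> ?U"
    by simp
  moreover have "y \<otimes>\<^bsub>C\<^esub> inv\<^bsub>C\<^esub> x \<in> ?V"
    using y x top by (simp add: m_assoc)
  ultimately have "y \<otimes>\<^bsub>C\<^esub> inv\<^bsub>C\<^esub> x \<in> ?U \<inter> ?V"
    by (rule IntI)
  then obtain s where s: "s \<in> X" "\<iota> s \<in> ?U \<inter> ?V"
    by (rule dense_image_meets_openin[OF dense openin_Int[OF U V]])
  have "x \<in> ?W"
    using x top ST by simp
  then obtain z where "z \<in> O2" "z \<in> ?W"
    by (rule closure_of_meets_openin[OF O(4) W])
  then have "z \<in> ?W \<inter> O2"
    by (intro IntI)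
  then obtain t where "t \<in> X" "\<iota> t \<in> ?W \<inter> O2"
    by (rule dense_image_meets_openin[OF dense openin_Int[OF W O(2)]])
  with s show ?thesis
    by (intro that[of s t]) auto
qed

text \<open>Dependent choice of pairs. The clauses of \<open>P\<close> on \<open>x\<close> and on
  \<open>\<iota> (snd q) \<in> O2\<close> are the invariants that make the next step possible; the
  others compare the new pair with all earlier ones.\<close>

lemma dense_double_sequence:
  assumes C: "topological_group C T" and dense: "T closure_of (\<iota> ` X) = topspace T"
    and \<iota>: "\<iota> ` X \<subseteq> carrier C"
    and O: "openin T O1" "openin T O2" "x \<in> T closure_of O1" "x \<in> T closure_of O2"
  obtains s t :: "nat \<Rightarrow> 'g" where "\<forall>n. s n \<in> X" "\<forall>n. t n \<in> X"
    "\<forall>m n. m < n \<longrightarrow> \<iota> (s m) \<otimes>\<^bsub>C\<^esub> \<iota> (t n) \<in> O1"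
    "\<forall>m n. n < m \<longrightarrow> \<iota> (s m) \<otimes>\<^bsub>C\<^esub> \<iota> (t n) \<in> O2"
proof -
  define P where "P p n q \<longleftrightarrow> fst q \<in> X \<and> snd q \<in> X \<and> \<iota> (fst q) \<otimes>\<^bsub>C\<^esub> x \<in> O1 \<and> \<iota> (snd q) \<in> O2 \<and>
      (\<forall>k<n. \<iota> (fst q) \<otimes>\<^bsub>C\<^esub> \<iota> (snd (p k)) \<in> O2 \<and> \<iota> (fst (p k)) \<otimes>\<^bsub>C\<^esub> \<iota> (snd q) \<in> O1)"
    for p :: "nat \<Rightarrow> 'g \<times> 'g" and n q
  have "\<exists>p. \<forall>n. P p n (p n)"
  proof (rule dependent_wellorder_choice)
    fix n p assume IH: "\<And>k. k < n \<Longrightarrow> P p k (p k)"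
    let ?S = "(\<lambda>k. \<iota> (fst (p k))) ` {..<n}" and ?R = "(\<lambda>k. \<iota> (snd (p k))) ` {..<n}"
    have "?S \<subseteq> carrier C" "?R \<subseteq> carrier C"
      "\<forall>r\<in>?S. r \<otimes>\<^bsub>C\<^esub> x \<in> O1" "?R \<subseteq> O2"
      using IH \<iota> unfolding P_def by auto
    then obtain s t where "s \<in> X" "t \<in> X" "\<iota> s \<otimes>\<^bsub>C\<^esub> x \<in> O1" "\<iota> t \<in> O2"
      "\<forall>r\<in>?R. \<iota> s \<otimes>\<^bsub>C\<^esub> r \<in> O2" "\<forall>r\<in>?S. r \<otimes>\<^bsub>C\<^esub> \<iota> t \<in> O1"
      by (rule dense_double_sequence_step[OF C dense O finite_imageI[OF finite_lessThan]
            finite_imageI[OF finite_lessThan]])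
    then have "P p n (s, t)"
      unfolding P_def by auto
    then show "\<exists>q. P p n q" ..
  \<comment> \<open>The remaining goal: \<open>P p n\<close> reads \<open>p\<close> only below
    \<open>n\<close>.\<close>
  qed (simp add: P_def)
  then obtain p where "\<And>n. P p n (p n)"
    by blast
  then show ?thesis
    unfolding P_def by (intro that[of "\<lambda>n. fst (p n)" "\<lambda>n. snd (p n)"]) auto
qed

theorem theorem4:
  fixes G :: "('g, 'm) monoid_scheme" and TG :: "'g topology"
    and C :: "('c, 'n) monoid_scheme" and TC :: "'c topology"
    and \<iota> :: "'g \<Rightarrow> 'c" and f :: "'g \<Rightarrow> complex" and F :: "'c \<Rightarrow> complex"
  assumes "topological_group G TG"
    and "f \<in> hartman G TG \<inter> weakly_almost_periodic G"
    and "group_compactification G TG \<iota> C TC"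
    and "riemann_integrable C TC F"
    and "\<forall>x\<in>carrier G. f x = F (\<iota> x)"
  shows "\<not> (\<exists>x\<in>topspace TC. gen_jump_discontinuity TC euclidean F x)"
proof
  assume "\<exists>x\<in>topspace TC. gen_jump_discontinuity TC euclidean F x"
  then obtain x O1 O2 where O: "openin TC O1" "openin TC O2"
      "x \<in> TC closure_of O1" "x \<in> TC closure_of O2"
    and disj: "closure (F ` O1) \<inter> closure (F ` O2) = {}"
    unfolding gen_jump_discontinuity_def by auto
  interpret group G
    using assms(1) by (simp add: topological_group_def)
  have C: "topological_group C TC" and hom: "\<iota> \<in> hom G C"
    and dense: "TC closure_of (\<iota> ` carrier G) = topspace TC"
    using assms(3) by (auto simp: group_compactification_def compact_topological_group_def)
  have "\<iota> ` carrier G \<subseteq> carrier C"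
    using hom by (auto simp: hom_def)
  then obtain s t :: "nat \<Rightarrow> 'g" where st: "\<forall>n. s n \<in> carrier G" "\<forall>n. t n \<in> carrier G"
    "\<forall>m n. m < n \<longrightarrow> \<iota> (s m) \<otimes>\<^bsub>C\<^esub> \<iota> (t n) \<in> O1"
    "\<forall>m n. n < m \<longrightarrow> \<iota> (s m) \<otimes>\<^bsub>C\<^esub> \<iota> (t n) \<in> O2"
    by (rule dense_double_sequence[OF C dense _ O])
  have "f (s m \<otimes>\<^bsub>G\<^esub> t n) = F (\<iota> (s m) \<otimes>\<^bsub>C\<^esub> \<iota> (t n))" for m n
    using assms(5) st(1,2) hom by (simp add: hom_mult)
  \<comment> \<open>The two value sets of the double limit condition are the images of
    \<open>O1\<close> and \<open>O2\<close> under \<open>F\<close>.\<close>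
  then have "closure (F ` O1) \<inter> closure (F ` O2) \<noteq> {}"
    using assms(2) st by (intro weakly_almost_periodic_double_limit[OF is_group, of f s t]) auto
  with disj show False
    by contradiction
qed

end
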